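(* For every power of two $d\ge256$, $\sup_{u\in S^{d-1}}W_1(T(u),X(u))>\frac13$; for every power of two $d\ge 32768$, $\sup_{u\in S^{d-1}}W_1(T(u),X(u))>0.6$. Moreover, \[ \liminf_{d\to\infty,\ d\in\{2^m:m\in\mathbb N\}}\ \sup_{u\in S^{d-1}}W_1\bigl(T(u),X(u)\bigr)\ge \sqrt{2\Bigl(1-\sqrt{\tfrac2\pi}\Bigr)}\approx0.6358 . \]
   Context: $H$ is the unnormalized $d\times d$ Walsh--Hadamard matrix ($H_1=(1)$, $H_{2n}=\begin{pmatrix}H_n&H_n\\H_n&-H_n\end{pmatrix}$). $D^{(1)},D^{(2)}$ are independent diagonal matrices with i.i.d. Rademacher diagonal entries. For deterministic $u\in S^{d-1}$ (the Euclidean unit sphere), $T(u)=\frac1d HD^{(1)}HD^{(2)}u$ and $X(u)=Ru$, with $R$ Haar-distributed on $\mathcal O(d)$. $W_1$ is the Wasserstein-1 distance with respect to the Euclidean norm: $W_1(Y,Z)=\sup_f|\mathbb{E}f(Y)-\mathbb{E}f(Z)|$ over $1$-Lipschitz $f:\mathbb{R}^d\to\mathbb{R}$. *)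

theory Defs
  imports "HOL-Probability.Probability"
begin

text \<open>Vectors of R^d are represented as functions nat => real vanishing at indices >= d;
  d x d matrices as functions nat * nat => real (only entries (i,j) with i,j < d matter).\<close>

definition vecs :: "nat \<Rightarrow> (nat \<Rightarrow> real) set" where
  "vecs d = {x. \<forall>i\<ge>d. x i = 0}"

definition vnorm :: "nat \<Rightarrow> (nat \<Rightarrow> real) \<Rightarrow> real" where
  "vnorm d x = sqrt (\<Sum>i<d. (x i)\<^sup>2)"

definition sphere_d :: "nat \<Rightarrow> (nat \<Rightarrow> real) set" where
  "sphere_d d = {u \<in> vecs d. vnorm d u = 1}"

definition matvec :: "nat \<Rightarrow> (nat \<times> nat \<Rightarrow> real) \<Rightarrow> (nat \<Rightarrow> real) \<Rightarrow> (nat \<Rightarrow> real)" where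
  "matvec d A x = (\<lambda>i. if i < d then (\<Sum>j<d. A (i, j) * x j) else 0)"

definition matmul :: "nat \<Rightarrow> (nat \<times> nat \<Rightarrow> real) \<Rightarrow> (nat \<times> nat \<Rightarrow> real) \<Rightarrow> (nat \<times> nat \<Rightarrow> real)" where
  "matmul d A B = (\<lambda>(i, j). if i < d \<and> j < d then (\<Sum>k<d. A (i, k) * B (k, j)) else undefined)"

definition orthogonal_d :: "nat \<Rightarrow> (nat \<times> nat \<Rightarrow> real) \<Rightarrow> bool" where
  "orthogonal_d d R \<longleftrightarrow>
     (\<forall>i<d. \<forall>j<d. (\<Sum>k<d. R (k, i) * R (k, j)) = (if i = j then 1 else 0))"

definition mat_space :: "nat \<Rightarrow> (nat \<times> nat \<Rightarrow> real) measure" where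
  "mat_space d = PiM ({..<d} \<times> {..<d}) (\<lambda>_. borel)"

definition haar_orth :: "nat \<Rightarrow> (nat \<times> nat \<Rightarrow> real) measure \<Rightarrow> bool" where
  "haar_orth d M \<longleftrightarrow>
     prob_space M \<and> sets M = sets (mat_space d) \<and> space M = space (mat_space d) \<and>
     (AE R in M. orthogonal_d d R) \<and>
     (\<forall>Q \<in> space (mat_space d). orthogonal_d d Q \<longrightarrow>
        distr M (mat_space d) (matmul d Q) = M)"

text \<open>Unnormalized Walsh--Hadamard matrix H_{2^m}, via the recursion
  H_1 = (1), H_{2n} = [[H_n, H_n], [H_n, -H_n]].\<close>
fun hadamard :: "nat \<Rightarrow> nat \<times> nat \<Rightarrow> real" where
  "hadamard 0 (i, j) = 1"
| "hadamard (Suc m) (i, j) =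
     (let n = 2 ^ m in
      if i < n then (if j < n then hadamard m (i, j) else hadamard m (i, j - n))
      else (if j < n then hadamard m (i - n, j) else - hadamard m (i - n, j - n)))"

definition signs :: "nat \<Rightarrow> (nat \<Rightarrow> real) set" where
  "signs d = {s. (\<forall>i<d. s i \<in> {-1, 1}) \<and> (\<forall>i\<ge>d. s i = 0)}"

definition diagmul :: "(nat \<Rightarrow> real) \<Rightarrow> (nat \<Rightarrow> real) \<Rightarrow> (nat \<Rightarrow> real)" where
  "diagmul s x = (\<lambda>i. s i * x i)"

definition Tmap :: "nat \<Rightarrow> (nat \<Rightarrow> real) \<Rightarrow> (nat \<Rightarrow> real) \<Rightarrow> (nat \<Rightarrow> real) \<Rightarrow> (nat \<Rightarrow> real)" where
  "Tmap m s1 s2 u =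
     (\<lambda>i. (1 / real (2 ^ m)) *
        matvec (2 ^ m) (hadamard m) (diagmul s1 (matvec (2 ^ m) (hadamard m) (diagmul s2 u))) i)"

text \<open>D1, D2 independent with i.i.d. Rademacher entries: (s1, s2) uniform.\<close>
definition rademacher_pair :: "nat \<Rightarrow> ((nat \<Rightarrow> real) \<times> (nat \<Rightarrow> real)) pmf" where
  "rademacher_pair d = pmf_of_set (signs d \<times> signs d)"

definition lip1 :: "nat \<Rightarrow> ((nat \<Rightarrow> real) \<Rightarrow> real) set" where
  "lip1 d = {f. \<forall>x\<in>vecs d. \<forall>y\<in>vecs d. \<bar>f x - f y\<bar> \<le> vnorm d (x - y)}"

definition W1_TX :: "nat \<Rightarrow> (nat \<times> nat \<Rightarrow> real) measure \<Rightarrow> (nat \<Rightarrow> real) \<Rightarrow> ereal" where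
  "W1_TX m M u =
     (SUP f \<in> lip1 (2 ^ m).
        ereal \<bar>measure_pmf.expectation (rademacher_pair (2 ^ m)) (\<lambda>(s1, s2). f (Tmap m s1 s2 u))
              - (\<integral>R. f (matvec (2 ^ m) R u) \<partial>M)\<bar>)"

definition supW1 :: "nat \<Rightarrow> (nat \<times> nat \<Rightarrow> real) measure \<Rightarrow> ereal" where
  "supW1 m M = (SUP u \<in> sphere_d (2 ^ m). W1_TX m M u)"

end

theory Submission
  imports Defs
begin

text \<open>For \<open>u\<close> the first unit vector, \<open>T u\<close> is \<open>U s / sqrt d\<close> with \<open>U = H / sqrt d\<close> orthogonal and
  \<open>s\<close> a uniform sign vector, whereas \<open>X = R u\<close> is uniform on the sphere. The distance to the
  rotated cube \<open>{U s / sqrt d}\<close> is a 1-Lipschitz test function which vanishes on \<open>T u\<close>; at a unit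
  vector \<open>y\<close> the nearest vertex has the signs of \<open>U y\<close>, so the distance is
  \<open>sqrt (2 - 2 t)\<close> with \<open>t = |U y|\<^sub>1 / sqrt d\<close>. For \<open>y = X\<close> the variable \<open>t\<close> concentrates
  at \<open>t\<^sub>0 = sqrt (2 / pi)\<close>, since \<open>E t \<ge> t\<^sub>0\<close> and \<open>E t\<^sup>2 = t\<^sub>0\<^sup>2 + (1 - t\<^sub>0\<^sup>2) / d\<close>. A quadratic
  minorant of \<open>sqrt (2 - 2 t)\<close> that touches it at \<open>t\<^sub>0\<close> then bounds the distance in mean from
  below by \<open>sqrt (2 - 2 t\<^sub>0) - 6 / d\<close>.\<close>

section \<open>The Walsh-Hadamard matrix\<close>

lemma hadamard_first_col: "i < 2 ^ m \<Longrightarrow> hadamard m (i, 0) = 1"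
proof (induction m arbitrary: i)
  case (Suc m)
  then show ?case by (cases "i < 2 ^ m") (auto simp: Let_def)
qed simp

lemma hadamard_sym: "hadamard m (i, j) = hadamard m (j, i)"
  by (induction m arbitrary: i j) (auto simp: Let_def)

text \<open>Summing over the upper and the lower block rows separately reduces each block to the
  induction hypothesis. For columns in different halves the minus sign of the lower right block
  cancels the two contributions.\<close>

lemma hadamard_orthogonal:
  assumes "i < 2 ^ m" "j < 2 ^ m"
  shows "(\<Sum>k<2 ^ m. hadamard m (k, i) * hadamard m (k, j)) = (if i = j then 2 ^ m else 0)"
  using assms
proof (induction m arbitrary: i j)
  case (Suc m)
  have split: "(\<Sum>k<2 ^ Suc m. g k) = (\<Sum>k<2 ^ m. g k) + (\<Sum>k<2 ^ m. g (2 ^ m + k))"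
    for g :: "nat \<Rightarrow> real"
  proof -
    have "(\<Sum>k<n + l. g k) = (\<Sum>k<n. g k) + (\<Sum>k<l. g (n + k))" for n l
      by (induction l) auto
    then show ?thesis by (simp add: mult_2)
  qed
  show ?case
    unfolding split using Suc.prems
    by (cases "i < 2 ^ m"; cases "j < 2 ^ m")
      (auto simp: Let_def Suc.IH sum_negf)
qed simp

section \<open>A scalar inequality and a trigonometric integral\<close>

text \<open>The square root is concave in \<open>t\<close>, so its tangent lies above it; with
  \<open>s = sqrt (2 - 2 * t)\<close> the tangent exceeds it by exactly
  \<open>(f - s)\<^sup>2 / (2 * f)\<close>. The quadratic term equals this excess times
  \<open>((f + s) / f)\<^sup>2\<close>, a factor of at least 1. The minorant needs only two moments
  of \<open>t\<close>.\<close>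

lemma sqrt_quadratic_minorant:
  fixes t t\<^sub>0 :: real
  assumes "t \<le> 1" "t\<^sub>0 < 1" and f: "f = sqrt (2 - 2 * t\<^sub>0)"
  shows "f - (t - t\<^sub>0) / f - 2 / f ^ 3 * (t - t\<^sub>0)\<^sup>2 \<le> sqrt (2 - 2 * t)"
proof -
  define s where "s = sqrt (2 - 2 * t)"
  have s: "0 \<le> s" "s\<^sup>2 = 2 - 2 * t" using assms by (auto simp: s_def)
  have f0: "0 < f" "f\<^sup>2 = 2 - 2 * t\<^sub>0" using assms by auto
  have t: "t - t\<^sub>0 = (f - s) * (f + s) / 2"
    using s f0 by (simp add: algebra_simps power2_eq_square)
  have "f\<^sup>2 \<le> (f + s)\<^sup>2" using s f0 by (intro power_mono) auto
  then have "(f - s)\<^sup>2 * f\<^sup>2 \<le> (f - s)\<^sup>2 * (f + s)\<^sup>2"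
    by (intro mult_left_mono) auto
  then have "(f - s)\<^sup>2 * f\<^sup>2 / (2 * f ^ 3) \<le> (f - s)\<^sup>2 * (f + s)\<^sup>2 / (2 * f ^ 3)"
    using f0 by (intro divide_right_mono) auto
  moreover have "(f - s)\<^sup>2 * f\<^sup>2 / (2 * f ^ 3) = (f - s)\<^sup>2 / (2 * f)"
    using f0(1) by (simp add: power2_eq_square power3_eq_cube)
  moreover have "(f - s)\<^sup>2 * (f + s)\<^sup>2 / (2 * f ^ 3) = 2 / f ^ 3 * (t - t\<^sub>0)\<^sup>2"
    unfolding t by (simp add: power_divide power_mult_distrib)
  moreover have "f - (t - t\<^sub>0) / f = s + (f - s)\<^sup>2 / (2 * f)"
    using f0 unfolding t by (simp add: field_simps power2_eq_square)
  ultimately show ?thesis by (simp add: s_def)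
qed

lemma has_integral_abs_cos_shift_pos:
  assumes "0 \<le> \<phi>" "\<phi> \<le> pi"
  shows "((\<lambda>x. \<bar>cos (x - \<phi>)\<bar>) has_integral 2) {0..pi}"
proof -
  have FTC: "((\<lambda>x. cos (x - \<phi>)) has_integral (sin (b - \<phi>) - sin (a - \<phi>))) {a..b}" if "a \<le> b" for a b
    using that by (intro fundamental_theorem_of_calculus)
      (auto intro!: derivative_eq_intros simp: has_real_derivative_iff_has_vector_derivative[symmetric])
  show ?thesis
  \<comment> \<open>The cosine changes sign at \<open>\<phi> + pi / 2\<close> in the first case and
    at \<open>\<phi> - pi / 2\<close> in the second; the interval is cut there.\<close>
  proof (cases "\<phi> \<le> pi / 2")
    case True
    have 1: "((\<lambda>x. \<bar>cos (x - \<phi>)\<bar>) has_integral (sin (pi / 2) - sin (- \<phi>))) {0..\<phi> + pi / 2}"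
      using has_integral_eq[OF _ FTC[of 0 "\<phi> + pi / 2"], of "\<lambda>x. \<bar>cos (x - \<phi>)\<bar>"] assms True
      by (auto simp: abs_of_nonneg cos_ge_zero)
    have "cos (x - \<phi>) \<le> 0" if "x \<in> {\<phi> + pi / 2..pi}" for x
      using cos_ge_zero[of "pi - (x - \<phi>)"] that assms by auto
    then have 2: "((\<lambda>x. \<bar>cos (x - \<phi>)\<bar>) has_integral - (sin (pi - \<phi>) - sin (pi / 2))) {\<phi> + pi / 2..pi}"
      using has_integral_eq[OF _ has_integral_neg[OF FTC[of "\<phi> + pi / 2" pi]], of "\<lambda>x. \<bar>cos (x - \<phi>)\<bar>"] assms True
      by (auto simp: abs_of_nonpos)
    show ?thesis using has_integral_combine[OF _ _ 1 2] assms True by simp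
  next
    case False
    have "cos (x - \<phi>) \<le> 0" if "x \<in> {0..\<phi> - pi / 2}" for x
      using cos_ge_zero[of "pi + (x - \<phi>)"] that assms by (auto simp: cos_add)
    then have 1: "((\<lambda>x. \<bar>cos (x - \<phi>)\<bar>) has_integral - (sin (- (pi / 2)) - sin (- \<phi>))) {0..\<phi> - pi / 2}"
      using has_integral_eq[OF _ has_integral_neg[OF FTC[of 0 "\<phi> - pi / 2"]], of "\<lambda>x. \<bar>cos (x - \<phi>)\<bar>"] assms False
      by (auto simp: abs_of_nonpos)
    have 2: "((\<lambda>x. \<bar>cos (x - \<phi>)\<bar>) has_integral (sin (pi - \<phi>) - sin (- (pi / 2)))) {\<phi> - pi / 2..pi}"
      using has_integral_eq[OF _ FTC[of "\<phi> - pi / 2" pi], of "\<lambda>x. \<bar>cos (x - \<phi>)\<bar>"] assms False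
      by (auto simp: abs_of_nonneg cos_ge_zero)
    show ?thesis using has_integral_combine[OF _ _ 1 2] assms False by simp
  qed
qed

text \<open>In polar form the integrand is \<open>r * \<bar>cos (x - \<phi>)\<bar>\<close> with
  amplitude \<open>r = sqrt (a\<^sup>2 + b\<^sup>2)\<close>.\<close>

lemma has_integral_abs_cos_sin:
  fixes a b :: real
  shows "((\<lambda>x. \<bar>a * cos x + b * sin x\<bar>) has_integral 2 * sqrt (a\<^sup>2 + b\<^sup>2)) {0..pi}"
proof -
  \<comment> \<open>The phase from \<open>arccos\<close> lies in \<open>{0..pi}\<close>, where the
    sine is nonnegative, hence the restriction to \<open>b \<ge> 0\<close>. Negating both
    coefficients covers the rest.\<close>
  have pos: "((\<lambda>x. \<bar>a * cos x + b * sin x\<bar>) has_integral 2 * sqrt (a\<^sup>2 + b\<^sup>2)) {0..pi}"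
    if "b \<ge> 0" for a b :: real
  proof (cases "a = 0 \<and> b = 0")
    case False
    define r where "r = sqrt (a\<^sup>2 + b\<^sup>2)"
    have r: "r > 0" "a\<^sup>2 + b\<^sup>2 = r\<^sup>2" using False by (auto simp: r_def sum_power2_gt_zero_iff)
    have "\<bar>a\<bar> \<le> r" by (simp add: r_def)
    then have ar: "-1 \<le> a / r" "a / r \<le> 1" using r by (auto simp: field_simps)
    define \<phi> where "\<phi> = arccos (a / r)"
    have c: "a = r * cos \<phi>" using ar r by (simp add: \<phi>_def)
    have "sin \<phi> = sqrt (1 - (a / r)\<^sup>2)" using ar by (simp add: \<phi>_def sin_arccos)
    also have "1 - (a / r)\<^sup>2 = (b / r)\<^sup>2" using r by (simp add: field_simps)
    finally have s: "b = r * sin \<phi>" using r that by simp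
    have "0 \<le> \<phi>" "\<phi> \<le> pi" using ar by (auto simp: \<phi>_def arccos_lbound arccos_ubound)
    from has_integral_mult_right[OF has_integral_abs_cos_shift_pos[OF this], of r]
    have "((\<lambda>x. r * \<bar>cos (x - \<phi>)\<bar>) has_integral 2 * r) {0..pi}" by (simp add: mult.commute)
    moreover have "r * \<bar>cos (x - \<phi>)\<bar> = \<bar>a * cos x + b * sin x\<bar>" for x
    proof -
      have "a * cos x + b * sin x = r * cos (x - \<phi>)"
        by (subst c, subst s) (simp add: cos_diff algebra_simps)
      then show ?thesis using r by (simp add: abs_mult)
    qed
    ultimately show ?thesis by (simp add: r_def)
  qed simp
  show ?thesis
  proof (cases "b \<ge> 0")
    case False
    have "\<bar>a * cos x + b * sin x\<bar> = \<bar>- a * cos x + - b * sin x\<bar>" for x by linarith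
    then show ?thesis using pos[of "- b" "- a"] False by simp
  qed (rule pos)
qed

subsection \<open>Gaussian vectors\<close>

abbreviation std_gaussian :: "real measure" where
  "std_gaussian \<equiv> density lborel (\<lambda>x. ennreal (std_normal_density x))"

abbreviation gaussian_vector :: "nat \<Rightarrow> (nat \<Rightarrow> real) measure" where
  "gaussian_vector d \<equiv> PiM {..<d} (\<lambda>_. std_gaussian)"

lemma prob_space_gaussian_vector: "prob_space (gaussian_vector d)"
  by (intro prob_space_PiM prob_space_normal_density) simp

lemma distributed_gaussian_vector_component:
  assumes "i < d"
  shows "distributed (gaussian_vector d) lborel (\<lambda>x. x i) std_normal_density"
proof -
  have "distr (gaussian_vector d) lborel (\<lambda>x. x i) = distr (gaussian_vector d) std_gaussian (\<lambda>x. x i)"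
    by (intro distr_cong) auto
  also have "\<dots> = std_gaussian"
    using assms by (intro distr_PiM_component prob_space_normal_density) auto
  finally show ?thesis using assms by (simp add: distributed_def)
qed

lemma indep_vars_gaussian_vector:
  assumes "0 < d"
  shows "prob_space.indep_vars (gaussian_vector d) (\<lambda>_. borel) (\<lambda>i x. x i) {..<d}"
proof -
  have 1: "distr (gaussian_vector d) (PiM {..<d} (\<lambda>_. borel)) (\<lambda>x. \<lambda>i\<in>{..<d}. x i) = gaussian_vector d"
  proof -
    have "distr (gaussian_vector d) (PiM {..<d} (\<lambda>_. borel)) (\<lambda>x. \<lambda>i\<in>{..<d}. x i)
      = distr (gaussian_vector d) (gaussian_vector d) (\<lambda>x. x)"
      by (intro distr_cong) (auto simp: space_PiM PiE_def extensional_restrict intro!: sets_PiM_cong)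
    then show ?thesis by simp
  qed
  have 2: "distr (gaussian_vector d) borel (\<lambda>x. x i) = std_gaussian" if "i < d" for i
  proof -
    have "distr (gaussian_vector d) borel (\<lambda>x. x i) = distr (gaussian_vector d) lborel (\<lambda>x. x i)"
      by (intro distr_cong) auto
    then show ?thesis
      using distributed_gaussian_vector_component[OF that] by (simp add: distributed_def)
  qed
  have "PiM {..<d} (\<lambda>i. distr (gaussian_vector d) borel (\<lambda>x. x i)) = gaussian_vector d"
    by (intro PiM_cong) (simp_all add: 2)
  then show ?thesis
    using assms 1
    by (subst prob_space.indep_vars_iff_distr_eq_PiM'[OF prob_space_gaussian_vector]) auto
qed

text \<open>Independent centred normals add up to a normal whose variance is the sum of the
  variances, here the squared norm of \<open>x\<close>.\<close>

lemma distributed_inner_gaussian_vector: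
  assumes x: "(\<Sum>i<d. (x i)\<^sup>2) = 1"
  shows "distributed (gaussian_vector d) lborel (\<lambda>g. \<Sum>i<d. x i * g i) std_normal_density"
proof -
  interpret prob_space "gaussian_vector d" by (rule prob_space_gaussian_vector)
  \<comment> \<open>Zero coefficients would give degenerate normals, which
    \<open>sum_indep_normal\<close> excludes, so the sum is restricted to the support of
    \<open>x\<close>.\<close>
  define J where "J = {i. i < d \<and> x i \<noteq> 0}"
  have J: "finite J" "J \<subseteq> {..<d}" by (auto simp: J_def)
  have sum_J: "(\<Sum>i\<in>J. f i) = (\<Sum>i<d. f i)" if "\<And>i. x i = 0 \<Longrightarrow> f i = 0" for f :: "nat \<Rightarrow> real"
    using that by (intro sum.mono_neutral_left) (auto simp: J_def)
  have "J \<noteq> {}"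
  proof
    assume "J = {}"
    then show False using x sum_J[of "\<lambda>i. (x i)\<^sup>2"] by simp
  qed
  then have "0 < d" using J by auto
  have "distributed (gaussian_vector d) lborel (\<lambda>g. \<Sum>i\<in>J. x i * g i)
    (normal_density (\<Sum>i\<in>J. 0) (sqrt (\<Sum>i\<in>J. \<bar>x i\<bar>\<^sup>2)))"
  proof (rule sum_indep_normal[OF J(1) \<open>J \<noteq> {}\<close>])
    show "indep_vars (\<lambda>i. borel) (\<lambda>i g. x i * g i) J"
      using indep_vars_compose2[OF indep_vars_subset[OF indep_vars_gaussian_vector[OF \<open>0 < d\<close>] J(2)],
          of "\<lambda>i y. x i * y" "\<lambda>_. borel"] by simp
    show "distributed (gaussian_vector d) lborel (\<lambda>g. x i * g i) (normal_density 0 \<bar>x i\<bar>)"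
      if "i \<in> J" for i
      using normal_density_affine[OF distributed_gaussian_vector_component[of i d], of "x i" 0] that
      by (simp add: J_def)
  qed (simp add: J_def)
  moreover have "(\<Sum>i\<in>J. (x i)\<^sup>2) = 1" using sum_J[of "\<lambda>i. (x i)\<^sup>2"] x by simp
  moreover have "(\<Sum>i\<in>J. x i * g i) = (\<Sum>i<d. x i * g i)" for g by (intro sum_J) auto
  ultimately show ?thesis by simp
qed

lemma nn_integral_abs_inner_gaussian_vector:
  assumes "(\<Sum>i<d. (x i)\<^sup>2) = 1"
  shows "(\<integral>\<^sup>+g. ennreal \<bar>\<Sum>i<d. x i * g i\<bar> \<partial>gaussian_vector d) = ennreal (sqrt (2 / pi))"
proof -
  have "(\<integral>\<^sup>+g. ennreal \<bar>\<Sum>i<d. x i * g i\<bar> \<partial>gaussian_vector d)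
    = (\<integral>\<^sup>+y. ennreal (std_normal_density y) * ennreal \<bar>y\<bar> \<partial>lborel)"
    by (rule distributed_nn_integral[OF distributed_inner_gaussian_vector[OF assms], symmetric]) simp
  also have "\<dots> = (\<integral>\<^sup>+y. ennreal (std_normal_density y * \<bar>y\<bar>) \<partial>lborel)"
    by (simp add: ennreal_mult)
  also have "\<dots> = ennreal (sqrt (2 / pi))"
    using std_normal_moment_abs_odd[of 0]
    by (subst nn_integral_eq_integral) (auto simp: has_bochner_integral_iff)
  finally show ?thesis .
qed

text \<open>The expected squared norm is \<open>d\<close>. An upper bound suffices because the norm
  later appears as a factor to be divided out of a lower bound.\<close>

lemma nn_integral_norm_gaussian_vector_le:
  "(\<integral>\<^sup>+g. ennreal (sqrt (\<Sum>i<d. (g i)\<^sup>2)) \<partial>gaussian_vector d) \<le> ennreal (sqrt d)"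
proof (cases "d = 0")
  case False
  interpret prob_space "gaussian_vector d" by (rule prob_space_gaussian_vector)
  have sq: "(\<integral>\<^sup>+g. ennreal ((g i)\<^sup>2) \<partial>gaussian_vector d) = 1" if "i < d" for i
  proof -
    have "(\<integral>\<^sup>+g. ennreal ((g i)\<^sup>2) \<partial>gaussian_vector d)
      = (\<integral>\<^sup>+y. ennreal (std_normal_density y) * ennreal (y\<^sup>2) \<partial>lborel)"
      by (rule distributed_nn_integral[OF distributed_gaussian_vector_component[OF that], symmetric]) simp
    also have "\<dots> = (\<integral>\<^sup>+y. ennreal (std_normal_density y * y\<^sup>2) \<partial>lborel)"
      by (simp add: ennreal_mult)
    also have "\<dots> = 1"
      using std_normal_moment_even[of 1]
      by (subst nn_integral_eq_integral) (auto simp: has_bochner_integral_iff)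
    finally show ?thesis .
  qed
  \<comment> \<open>AM-GM, \<open>2 r \<le> r\<^sup>2 / sqrt d + sqrt d\<close>, in place of Cauchy-Schwarz\<close>
  have am_gm: "sqrt s \<le> s * (1 / (2 * sqrt d)) + sqrt d / 2" if "s \<ge> 0" for s :: real
  proof -
    have "0 \<le> (sqrt s - sqrt d)\<^sup>2" by simp
    then have "2 * sqrt s * sqrt d \<le> s + d" using that by (simp add: power2_diff)
    then show ?thesis using False by (simp add: field_simps)
  qed
  have "(\<integral>\<^sup>+g. ennreal (sqrt (\<Sum>i<d. (g i)\<^sup>2)) \<partial>gaussian_vector d)
    \<le> (\<integral>\<^sup>+g. (\<Sum>i<d. ennreal ((g i)\<^sup>2)) * ennreal (1 / (2 * sqrt d)) + ennreal (sqrt d / 2) \<partial>gaussian_vector d)"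
    using am_gm
    by (intro nn_integral_mono)
      (simp add: sum_nonneg ennreal_mult[symmetric] ennreal_plus[symmetric] del: ennreal_plus)
  also have "\<dots> = (\<Sum>i<d. 1) * ennreal (1 / (2 * sqrt d)) + ennreal (sqrt d / 2)"
    by (simp add: nn_integral_add nn_integral_multc nn_integral_sum sq emeasure_space_1
        del: sum_ennreal)
  also have "\<dots> = ennreal (d / (2 * sqrt d) + sqrt d / 2)"
    by (simp add: ennreal_of_nat_eq_real_of_nat ennreal_mult[symmetric]
        ennreal_plus[symmetric] del: ennreal_plus)
  also have "d / (2 * sqrt d) + sqrt d / 2 = sqrt d"
    using real_div_sqrt[of d] by (simp add: field_simps)
  finally show ?thesis .
qed simp

subsection \<open>First column of a Haar orthogonal matrix\<close>

text \<open>This is the Householder reflection in the hyperplane orthogonal to \<open>n\<close>. For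
  \<open>n = 0\<close> the convention that division by 0 gives 0 makes it the identity.\<close>

lemma orthogonal_d_reflection:
  fixes d :: nat and n :: "nat \<Rightarrow> real"
  defines "N \<equiv> \<Sum>k<d. (n k)\<^sup>2"
  shows "orthogonal_d d (\<lambda>(i, j). (if i = j then 1 else 0) - 2 * n i * n j / N)"
  unfolding orthogonal_d_def
proof (intro allI impI)
  fix p q assume pq: "p < d" "q < d"
  have "(\<Sum>k<d. ((if k = p then 1 else 0) - 2 * n k * n p / N) * ((if k = q then 1 else 0) - 2 * n k * n q / N))
    = (\<Sum>k<d. (if k = p then if p = q then 1 else 0 else 0) - (if k = p then 2 * n p * n q / N else 0)
        - (if k = q then 2 * n q * n p / N else 0) + 4 * n p * n q / N\<^sup>2 * (n k)\<^sup>2)"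
    by (intro sum.cong) (auto simp: algebra_simps power2_eq_square)
  also have "\<dots> = (if p = q then 1 else 0) - 4 * n p * n q / N + 4 * n p * n q / N\<^sup>2 * N"
  proof -
    have "(\<Sum>k<d. 4 * n p * n q / N\<^sup>2 * (n k)\<^sup>2) = 4 * n p * n q / N\<^sup>2 * N"
      by (simp only: N_def sum_distrib_left)
    then show ?thesis using pq by (simp add: sum.distrib sum_subtractf)
  qed
  also have "\<dots> = (if p = q then 1 else 0)"
    by (simp add: power2_eq_square)
  finally show "(\<Sum>k<d. (case (k, p) of (i, j) \<Rightarrow> (if i = j then 1 else 0) - 2 * n i * n j / N) *
      (case (k, q) of (i, j) \<Rightarrow> (if i = j then 1 else 0) - 2 * n i * n j / N)) = (if p = q then 1 else 0)"
    by simp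
qed

lemma orthogonal_d_plane_rotation:
  fixes c s :: real
  assumes "i < d" "j < d" "i \<noteq> j" "c\<^sup>2 + s\<^sup>2 = 1"
  shows "orthogonal_d d (\<lambda>(a, b). if a = i then (if b = i then c else if b = j then s else 0)
    else if a = j then (if b = i then - s else if b = j then c else 0) else if a = b then 1 else 0)"
    (is "orthogonal_d d ?Q")
  unfolding orthogonal_d_def
proof (intro allI impI)
  fix p q assume pq: "p < d" "q < d"
  let ?f = "\<lambda>k. ?Q (k, p) * ?Q (k, q)"
  have "(\<Sum>k<d. ?f k) = ?f i + (?f j + (\<Sum>k\<in>{..<d} - {i} - {j}. ?f k))"
    using assms by (subst sum.remove[of _ i], simp, simp, subst sum.remove[of _ j]) auto
  also have "(\<Sum>k\<in>{..<d} - {i} - {j}. ?f k)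
      = (\<Sum>k\<in>{..<d} - {i} - {j}. if k = p then if p = q then 1 else 0 else 0)"
    by (intro sum.cong) auto
  also have "\<dots> = (if p \<noteq> i \<and> p \<noteq> j \<and> p = q then 1 else 0)"
    using pq by (simp add: sum.delta)
  finally show "(\<Sum>k<d. ?f k) = (if p = q then 1 else 0)"
    using assms by (auto simp: power2_eq_square add.commute)
qed

locale haar_orthogonal =
  fixes d :: nat and M :: "(nat \<times> nat \<Rightarrow> real) measure"
  assumes haar: "haar_orth d M" and dim_pos: "0 < d"
begin

sublocale prob_space M
  using haar by (simp add: haar_orth_def)

lemma sets_M [measurable_cong]: "sets M = sets (mat_space d)"
  using haar by (simp add: haar_orth_def)

lemma borel_measurable_entry [measurable]:
  "i < d \<Longrightarrow> j < d \<Longrightarrow> (\<lambda>R. R (i, j)) \<in> borel_measurable M"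
  unfolding measurable_cong_sets[OF sets_M refl] mat_space_def
  by (rule measurable_component_singleton) auto

lemma borel_measurable_first_col [measurable]: "i < d \<Longrightarrow> (\<lambda>R. R (i, 0)) \<in> borel_measurable M"
  using dim_pos by simp

lemma measurable_matmul [measurable]: "matmul d Q \<in> measurable M (mat_space d)"
proof -
  have "matmul d Q = (\<lambda>R. \<lambda>p\<in>{..<d} \<times> {..<d}. \<Sum>k<d. Q (fst p, k) * R (k, snd p))"
    by (auto simp: matmul_def fun_eq_iff restrict_def)
  also have "\<dots> \<in> measurable M (mat_space d)"
    unfolding mat_space_def
    by (rule measurable_restrict) (auto intro!: borel_measurable_sum)
  finally show ?thesis .
qed

text \<open>The first column of \<open>Q R\<close> is \<open>Q\<close> applied to the first column
  of \<open>R\<close>, so left invariance of the Haar measure passes to the law of that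
  column.\<close>

lemma integral_first_col_rotate:
  fixes g :: "(nat \<Rightarrow> real) \<Rightarrow> real"
  assumes Q: "orthogonal_d d Q" and g: "g \<in> borel_measurable (PiM {..<d} (\<lambda>_. borel))"
  shows "(\<integral>R. g (\<lambda>i\<in>{..<d}. \<Sum>k<d. Q (i, k) * R (k, 0)) \<partial>M) = (\<integral>R. g (\<lambda>i\<in>{..<d}. R (i, 0)) \<partial>M)"
proof -
  \<comment> \<open>Invariance is stated for matrices in \<open>space (mat_space d)\<close>, whose
    members are \<open>undefined\<close> off the index square.\<close>
  define Q' where "Q' = restrict Q ({..<d} \<times> {..<d})"
  have "Q' \<in> space (mat_space d)" by (auto simp: Q'_def mat_space_def space_PiM)
  moreover have "orthogonal_d d Q'" using Q by (simp add: Q'_def orthogonal_d_def)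
  ultimately have inv: "distr M (mat_space d) (matmul d Q') = M"
    using haar by (simp add: haar_orth_def)
  have [measurable]: "(\<lambda>R. g (\<lambda>i\<in>{..<d}. R (i, 0))) \<in> borel_measurable (mat_space d)"
    by (rule measurable_compose[OF _ g], unfold mat_space_def, rule measurable_restrict,
        rule measurable_component_singleton) (use dim_pos in auto)
  have "(\<integral>R. g (\<lambda>i\<in>{..<d}. R (i, 0)) \<partial>M) = (\<integral>R. g (\<lambda>i\<in>{..<d}. matmul d Q' R (i, 0)) \<partial>M)"
    by (subst inv[symmetric], rule integral_distr) measurable
  also have "\<dots> = (\<integral>R. g (\<lambda>i\<in>{..<d}. \<Sum>k<d. Q (i, k) * R (k, 0)) \<partial>M)"
    using dim_pos by (auto simp: matmul_def Q'_def cong: restrict_cong)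
  finally show ?thesis ..
qed

lemma AE_first_col_unit: "AE R in M. (\<Sum>i<d. (R (i, 0))\<^sup>2) = 1"
proof -
  have "AE R in M. orthogonal_d d R" using haar by (simp add: haar_orth_def)
  then show ?thesis
    by eventually_elim (use dim_pos in \<open>auto simp: orthogonal_d_def power2_eq_square\<close>)
qed

lemma AE_first_col_le_1: "AE R in M. \<forall>i<d. \<bar>R (i, 0)\<bar> \<le> 1"
  using AE_first_col_unit
proof eventually_elim
  case (elim R)
  have "(R (i, 0))\<^sup>2 \<le> 1" if "i < d" for i
    using member_le_sum[of i "{..<d}" "\<lambda>i. (R (i, 0))\<^sup>2"] that elim by auto
  then show ?case by (simp add: abs_square_le_1)
qed

lemma integrable_entry_mult:
  "i < d \<Longrightarrow> j < d \<Longrightarrow> integrable M (\<lambda>R. R (i, 0) * R (j, 0))"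
  using AE_first_col_le_1
  by (intro integrable_const_bound[where B = 1])
    (auto simp: abs_mult mult_le_one elim!: eventually_mono)

lemma integrable_entry: "i < d \<Longrightarrow> integrable M (\<lambda>R. R (i, 0))"
  using AE_first_col_le_1
  by (intro integrable_const_bound[where B = 1]) (auto elim!: eventually_mono)

text \<open>All one-dimensional marginals of the first column agree: a Householder reflection that
  exchanges the first unit vector with \<open>w\<close> has \<open>w\<close> as its first
  row.\<close>

lemma integral_inner_first_col:
  fixes g :: "real \<Rightarrow> real"
  assumes w: "(\<Sum>i<d. (w i)\<^sup>2) = 1" and [measurable]: "g \<in> borel_measurable borel"
  shows "(\<integral>R. g (\<Sum>i<d. w i * R (i, 0)) \<partial>M) = (\<integral>R. g (R (0, 0)) \<partial>M)"
proof -
  define n where "n i = w i - (if i = 0 then 1 else 0)" for i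
  define N where "N = (\<Sum>k<d. (n k)\<^sup>2)"
  have "N = (\<Sum>k<d. (w k)\<^sup>2 + (if k = 0 then 1 - 2 * w k else 0))"
    unfolding N_def n_def by (intro sum.cong) (auto simp: power2_eq_square algebra_simps)
  also have "\<dots> = 2 - 2 * w 0" using w dim_pos by (simp add: sum.distrib)
  finally have N: "N = 2 - 2 * w 0" .
  \<comment> \<open>If \<open>N = 0\<close>, then \<open>w\<close> is the first unit vector and the
    reflection degenerates to the identity.\<close>
  have row: "(if 0 = k then 1 else 0) - 2 * n 0 * n k / N = w k" if "k < d" for k
  proof (cases "N = 0")
    case True
    then have "n k = 0" using that by (simp add: N_def sum_nonneg_eq_0_iff)
    then show ?thesis by (auto simp: n_def)
  next
    case False
    have "2 * n 0 = - N" by (simp add: n_def N)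
    then show ?thesis using False by (simp add: n_def)
  qed
  have "(\<integral>R. g (R (0, 0)) \<partial>M) = (\<integral>R. g ((\<lambda>i\<in>{..<d}. R (i, 0)) 0) \<partial>M)"
    using dim_pos by simp
  also have "\<dots> = (\<integral>R. g (\<Sum>k<d. ((if 0 = k then 1 else 0) - 2 * n 0 * n k / N) * R (k, 0)) \<partial>M)"
    using dim_pos
    by (subst integral_first_col_rotate[OF orthogonal_d_reflection[of d n], folded N_def,
          of "\<lambda>x. g (x 0)", symmetric]) auto
  also have "\<dots> = (\<integral>R. g (\<Sum>k<d. w k * R (k, 0)) \<partial>M)"
    by (intro Bochner_Integration.integral_cong refl arg_cong[of _ _ g] sum.cong) (subst row, auto)
  finally show ?thesis ..
qed

lemma integral_entry:
  fixes g :: "real \<Rightarrow> real"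
  assumes "i < d" "g \<in> borel_measurable borel"
  shows "(\<integral>R. g (R (i, 0)) \<partial>M) = (\<integral>R. g (R (0, 0)) \<partial>M)"
  using integral_inner_first_col[of "\<lambda>k. if k = i then 1 else 0" g] assms
  by (simp add: if_distrib[of "\<lambda>x. x * _"] if_distrib[of "\<lambda>x. x\<^sup>2"] cong: if_cong)

text \<open>The \<open>d\<close> second moments are equal and add up to the squared norm 1.\<close>

lemma integral_entry_sq: "i < d \<Longrightarrow> (\<integral>R. (R (i, 0))\<^sup>2 \<partial>M) = 1 / d"
proof -
  assume i: "i < d"
  have int: "integrable M (\<lambda>R. (R (k, 0))\<^sup>2)" if "k < d" for k
    using integrable_entry_mult[OF that that] by (simp add: power2_eq_square)
  have same: "(\<integral>R. (R (k, 0))\<^sup>2 \<partial>M) = (\<integral>R. (R (i, 0))\<^sup>2 \<partial>M)" if "k < d" for k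
    using trans[OF integral_entry[OF that, of "\<lambda>x. x\<^sup>2"]
        integral_entry[OF i, of "\<lambda>x. x\<^sup>2", symmetric]] by simp
  have "1 = (\<integral>R. (\<Sum>k<d. (R (k, 0))\<^sup>2) \<partial>M)"
  proof -
    have "(\<integral>R. (\<Sum>k<d. (R (k, 0))\<^sup>2) \<partial>M) = (\<integral>R. 1 \<partial>M)"
      using AE_first_col_unit by (intro integral_cong_AE) auto
    then show ?thesis by (simp add: prob_space)
  qed
  also have "\<dots> = (\<Sum>k<d. (\<integral>R. (R (k, 0))\<^sup>2 \<partial>M))"
    by (intro Bochner_Integration.integral_sum int) auto
  also have "\<dots> = (\<Sum>k<d. (\<integral>R. (R (i, 0))\<^sup>2 \<partial>M))"
    by (intro sum.cong refl same) auto
  finally show ?thesis using dim_pos by (simp add: field_simps)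
qed

lemma integral_plane_rotation:
  assumes ij: "i < d" "j < d" "i \<noteq> j" and cs: "c\<^sup>2 + s\<^sup>2 = 1"
  shows "(\<integral>R. \<bar>(c * R (i, 0) + s * R (j, 0)) * (c * R (j, 0) - s * R (i, 0))\<bar> \<partial>M)
    = (\<integral>R. \<bar>R (i, 0) * R (j, 0)\<bar> \<partial>M)"
proof -
  have row: "(\<Sum>k<d. (if k = i then a else if k = j then b else 0) * x k) = a * x i + b * x j"
    for a b :: real and x
  proof -
    have "(\<Sum>k<d. (if k = i then a else if k = j then b else 0) * x k)
        = (\<Sum>k<d. (if k = i then a * x k else 0) + (if k = j then b * x k else 0))"
      using ij by (intro sum.cong) auto
    then show ?thesis using ij by (simp add: sum.distrib)
  qed
  show ?thesis
    using integral_first_col_rotate[OF orthogonal_d_plane_rotation[OF ij cs], of "\<lambda>x. \<bar>x i * x j\<bar>"] ij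
    by (simp add: row)
qed

text \<open>Scaling \<open>v\<close> to a unit vector reduces this to the common one-dimensional
  marginal.\<close>

lemma integral_abs_inner_first_col:
  "(\<integral>R. \<bar>\<Sum>i<d. v i * R (i, 0)\<bar> \<partial>M) = sqrt (\<Sum>i<d. (v i)\<^sup>2) * (\<integral>R. \<bar>R (0, 0)\<bar> \<partial>M)"
proof (cases "(\<Sum>i<d. (v i)\<^sup>2) = 0")
  case True
  then have "v i = 0" if "i < d" for i using that by (simp add: sum_nonneg_eq_0_iff)
  then show ?thesis using True by simp
next
  case False
  define r where "r = sqrt (\<Sum>i<d. (v i)\<^sup>2)"
  have "r > 0" using False by (simp add: r_def order.not_eq_order_implies_strict sum_nonneg)
  have "r\<^sup>2 = (\<Sum>i<d. (v i)\<^sup>2)" by (simp add: r_def sum_nonneg)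
  then have "(\<Sum>i<d. (v i / r)\<^sup>2) = 1"
    using False by (simp add: power_divide sum_divide_distrib[symmetric])
  from integral_inner_first_col[OF this, of "\<lambda>x. r * \<bar>x\<bar>"]
  have "(\<integral>R. r * \<bar>\<Sum>i<d. v i / r * R (i, 0)\<bar> \<partial>M) = r * (\<integral>R. \<bar>R (0, 0)\<bar> \<partial>M)"
    by simp
  moreover have "r * \<bar>\<Sum>i<d. v i / r * x i\<bar> = \<bar>\<Sum>i<d. v i * x i\<bar>" for x
    using \<open>r > 0\<close> by (simp add: sum_divide_distrib[symmetric] abs_divide)
  ultimately show ?thesis by (simp only: r_def)
qed

text \<open>With a standard Gaussian vector \<open>G\<close> independent of the first column \<open>X\<close>,
  \<open>sqrt (2 / pi) = E |<X, G>| = E |G| * E |X\<^sub>0|\<close>, by conditioning on \<open>X\<close> and on \<open>G\<close>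
  respectively.\<close>

lemma integral_abs_entry_ge: "sqrt (2 / pi) / sqrt d \<le> (\<integral>R. \<bar>R (0, 0)\<bar> \<partial>M)"
proof -
  define e where "e = (\<integral>R. \<bar>R (0, 0)\<bar> \<partial>M)"
  have "e \<ge> 0" by (simp add: e_def)
  let ?G = "gaussian_vector d"
  interpret G: prob_space ?G by (rule prob_space_gaussian_vector)
  interpret pair_sigma_finite M ?G ..
  have [measurable]: "(\<lambda>g. g i) \<in> borel_measurable ?G" if "i < d" for i
    using distributed_gaussian_vector_component[OF that] by (simp add: distributed_def)
  have "ennreal (sqrt (2 / pi)) = (\<integral>\<^sup>+R. ennreal (sqrt (2 / pi)) \<partial>M)"
    by (simp add: emeasure_space_1)
  also have "\<dots> = (\<integral>\<^sup>+R. (\<integral>\<^sup>+g. ennreal \<bar>\<Sum>i<d. R (i, 0) * g i\<bar> \<partial>?G) \<partial>M)"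
    using AE_first_col_unit
    by (intro nn_integral_cong_AE) (auto elim!: eventually_mono simp: nn_integral_abs_inner_gaussian_vector)
  also have "\<dots> = (\<integral>\<^sup>+g. (\<integral>\<^sup>+R. ennreal \<bar>\<Sum>i<d. R (i, 0) * g i\<bar> \<partial>M) \<partial>?G)"
    by (intro Fubini'[symmetric]) measurable
  also have "\<dots> = (\<integral>\<^sup>+g. ennreal (sqrt (\<Sum>i<d. (g i)\<^sup>2)) * ennreal e \<partial>?G)"
  proof (intro nn_integral_cong)
    fix g :: "nat \<Rightarrow> real"
    have "integrable M (\<lambda>R. \<bar>\<Sum>i<d. R (i, 0) * g i\<bar>)"
      by (intro integrable_abs Bochner_Integration.integrable_sum integrable_mult_left integrable_entry) auto
    then show "(\<integral>\<^sup>+R. ennreal \<bar>\<Sum>i<d. R (i, 0) * g i\<bar> \<partial>M) = ennreal (sqrt (\<Sum>i<d. (g i)\<^sup>2)) * ennreal e"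
      using integral_abs_inner_first_col[of g]
      by (simp add: nn_integral_eq_integral mult.commute e_def ennreal_mult'[symmetric])
  qed
  also have "\<dots> = (\<integral>\<^sup>+g. ennreal (sqrt (\<Sum>i<d. (g i)\<^sup>2)) \<partial>?G) * ennreal e"
    by (intro nn_integral_multc) measurable
  also have "\<dots> \<le> ennreal (sqrt d) * ennreal e"
    by (intro mult_right_mono nn_integral_norm_gaussian_vector_le) simp
  finally have "sqrt (2 / pi) \<le> sqrt d * e"
    using \<open>e \<ge> 0\<close> by (simp add: ennreal_mult[symmetric])
  then show ?thesis using dim_pos by (simp add: e_def field_simps)
qed

text \<open>The law of \<open>(X\<^sub>i, X\<^sub>j)\<close> is invariant under rotations of the plane; averaging
  \<open>|X\<^sub>i X\<^sub>j|\<close> over all of them leaves \<open>(X\<^sub>i\<^sup>2 + X\<^sub>j\<^sup>2) / pi\<close>.\<close>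

lemma integral_abs_entry_mult:
  assumes ij: "i < d" "j < d" "i \<noteq> j"
  shows "(\<integral>R. \<bar>R (i, 0) * R (j, 0)\<bar> \<partial>M) = 2 / (pi * d)"
proof -
  define e where "e = (\<integral>R. \<bar>R (i, 0) * R (j, 0)\<bar> \<partial>M)"
  have "e \<ge> 0" by (simp add: e_def)
  \<comment> \<open>This is the product of the two coordinates after rotation by
    \<open>x / 2\<close>; the double angle formulas turn it into a linear form in
    \<open>cos x\<close> and \<open>sin x\<close>.\<close>
  define h where "h R x = \<bar>R (i, 0) * R (j, 0) * cos x + ((R (j, 0))\<^sup>2 - (R (i, 0))\<^sup>2) / 2 * sin x\<bar>"
    for R :: "nat \<times> nat \<Rightarrow> real" and x
  have h: "h R x = \<bar>(cos (x / 2) * R (i, 0) + sin (x / 2) * R (j, 0)) *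
      (cos (x / 2) * R (j, 0) - sin (x / 2) * R (i, 0))\<bar>" for R x
  proof -
    have "cos x = (cos (x / 2))\<^sup>2 - (sin (x / 2))\<^sup>2" "sin x = 2 * sin (x / 2) * cos (x / 2)"
      using cos_double[of "x / 2"] sin_double[of "x / 2"] by simp_all
    then show ?thesis
      unfolding h_def by (intro arg_cong[of _ _ abs], simp only:) (simp add: field_simps power2_eq_square)
  qed
  have [measurable]: "case_prod h \<in> borel_measurable (M \<Otimes>\<^sub>M lborel)"
    unfolding h_def using ij by measurable
  have int: "integrable M (\<lambda>R. h R x)" for x
    unfolding h_def power2_eq_square
    by (intro integrable_abs Bochner_Integration.integrable_add integrable_mult_left
        integrable_divide Bochner_Integration.integrable_diff integrable_entry_mult ij)
  interpret pair_sigma_finite M lborel ..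
  have "ennreal e * ennreal pi = (\<integral>\<^sup>+x. ennreal e * indicator {0..pi} x \<partial>lborel)"
    by (simp add: nn_integral_cmult_indicator)
  also have "\<dots> = (\<integral>\<^sup>+x. (\<integral>\<^sup>+R. ennreal (h R x) \<partial>M) * indicator {0..pi} x \<partial>lborel)"
    using integral_plane_rotation[OF ij sin_cos_squared_add2] int
    by (simp add: nn_integral_eq_integral e_def h)
  also have "\<dots> = (\<integral>\<^sup>+x. (\<integral>\<^sup>+R. ennreal (h R x) * indicator {0..pi} x \<partial>M) \<partial>lborel)"
    by (intro nn_integral_cong nn_integral_multc[symmetric]) measurable
  also have "\<dots> = (\<integral>\<^sup>+R. (\<integral>\<^sup>+x. ennreal (h R x) * indicator {0..pi} x \<partial>lborel) \<partial>M)"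
    by (intro Fubini') measurable
  also have "\<dots> = (\<integral>\<^sup>+R. ennreal ((R (i, 0))\<^sup>2 + (R (j, 0))\<^sup>2) \<partial>M)"
  proof (intro nn_integral_cong)
    fix R :: "nat \<times> nat \<Rightarrow> real"
    \<comment> \<open>The amplitude of the linear form is a perfect square under the root, so its
      integral over \<open>{0..pi}\<close> is the sum of the two squares.\<close>
    have "(R (i, 0) * R (j, 0))\<^sup>2 + (((R (j, 0))\<^sup>2 - (R (i, 0))\<^sup>2) / 2)\<^sup>2 = (((R (i, 0))\<^sup>2 + (R (j, 0))\<^sup>2) / 2)\<^sup>2"
      by (simp add: field_simps power2_eq_square)
    then have "2 * sqrt ((R (i, 0) * R (j, 0))\<^sup>2 + (((R (j, 0))\<^sup>2 - (R (i, 0))\<^sup>2) / 2)\<^sup>2) = (R (i, 0))\<^sup>2 + (R (j, 0))\<^sup>2"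
      by simp
    then show "(\<integral>\<^sup>+x. ennreal (h R x) * indicator {0..pi} x \<partial>lborel) = ennreal ((R (i, 0))\<^sup>2 + (R (j, 0))\<^sup>2)"
      unfolding h_def
      by (subst nn_integral_has_integral_lebesgue'[OF _ has_integral_abs_cos_sin]) simp_all
  qed
  also have "\<dots> = ennreal (\<integral>R. (R (i, 0))\<^sup>2 + (R (j, 0))\<^sup>2 \<partial>M)"
    unfolding power2_eq_square
    by (intro nn_integral_eq_integral Bochner_Integration.integrable_add integrable_entry_mult ij) simp
  also have "(\<integral>R. (R (i, 0))\<^sup>2 + (R (j, 0))\<^sup>2 \<partial>M) = 2 / d"
    using ij integrable_entry_mult[of i i] integrable_entry_mult[of j j]
    by (subst Bochner_Integration.integral_add) (simp_all add: integral_entry_sq power2_eq_square[symmetric])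
  finally have "e * pi = 2 / d"
    using \<open>e \<ge> 0\<close> by (simp add: ennreal_mult[symmetric])
  then have "e = 2 / d / pi"
    by (metis nonzero_eq_divide_eq pi_neq_zero)
  then show ?thesis by (simp add: e_def mult.commute)
qed

section \<open>First two moments of the scaled l1 norm of the column\<close>

definition l1 :: "(nat \<times> nat \<Rightarrow> real) \<Rightarrow> real" where
  "l1 R = (\<Sum>i<d. \<bar>R (i, 0)\<bar>) / sqrt d"

lemma l1_sq: "(l1 R)\<^sup>2 = (\<Sum>i<d. \<Sum>j<d. \<bar>R (i, 0) * R (j, 0)\<bar>) / d"
  by (simp add: l1_def power_divide power2_eq_square sum_product abs_mult)

lemma integrable_l1: "integrable M l1"
  unfolding l1_def by (intro integrable_divide Bochner_Integration.integrable_sum integrable_abs integrable_entry) auto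

lemma integrable_l1_sq: "integrable M (\<lambda>R. (l1 R)\<^sup>2)"
  unfolding l1_sq by (intro integrable_divide Bochner_Integration.integrable_sum integrable_abs integrable_entry_mult) auto

lemma integral_l1_ge: "sqrt (2 / pi) \<le> (\<integral>R. l1 R \<partial>M)"
proof -
  have "(\<integral>R. l1 R \<partial>M) = (\<Sum>i<d. \<integral>R. \<bar>R (i, 0)\<bar> \<partial>M) / sqrt d"
    unfolding l1_def by (subst integral_divide_zero, subst Bochner_Integration.integral_sum) (auto intro: integrable_abs integrable_entry)
  also have "\<dots> = (\<Sum>i<d. \<integral>R. \<bar>R (0, 0)\<bar> \<partial>M) / sqrt d"
    by (intro arg_cong2[of _ _ _ _ "(/)"] sum.cong refl integral_entry) auto
  also have "\<dots> = (\<integral>R. \<bar>R (0, 0)\<bar> \<partial>M) * (d / sqrt d)"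
    by simp
  also have "d / sqrt d = sqrt d"
    by (rule real_div_sqrt) simp
  finally show ?thesis
    using integral_abs_entry_ge dim_pos by (simp add: field_simps)
qed

lemma integral_l1_sq: "(\<integral>R. (l1 R)\<^sup>2 \<partial>M) = 2 / pi + (1 - 2 / pi) / d"
proof -
  have "(\<integral>R. (l1 R)\<^sup>2 \<partial>M) = (\<Sum>i<d. \<Sum>j<d. \<integral>R. \<bar>R (i, 0) * R (j, 0)\<bar> \<partial>M) / d"
    unfolding l1_sq integral_divide_zero
    by (intro arg_cong2[of _ _ _ _ "(/)"] refl)
      (subst Bochner_Integration.integral_sum, auto intro!: Bochner_Integration.integrable_sum
        integrable_abs integrable_entry_mult sum.cong Bochner_Integration.integral_sum)
  \<comment> \<open>The off-diagonal value is used everywhere and corrected on the diagonal, where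
    the moment is \<open>1 / d\<close>.\<close>
  also have "\<dots> = (\<Sum>i<d. \<Sum>j<d. 2 / (pi * d) + (if j = i then 1 / d - 2 / (pi * d) else 0)) / d"
    by (intro arg_cong2[of _ _ _ _ "(/)"] sum.cong refl)
      (auto simp: integral_abs_entry_mult integral_entry_sq abs_mult_self_eq power2_eq_square[symmetric])
  also have "\<dots> = (d * (d * (2 / (pi * d)) + (1 / d - 2 / (pi * d)))) / d"
    by (simp add: sum.distrib)
  also have "\<dots> = 2 / pi + (1 - 2 / pi) / d"
    using dim_pos by (simp add: field_simps)
  finally show ?thesis .
qed

end

subsection \<open>Distance to a rotated cube\<close>

text \<open>After expanding the square and summing over \<open>i\<close> first, orthonormality of
  the columns leaves only the diagonal terms.\<close>

lemma orthogonal_d_sum_sq: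
  assumes "orthogonal_d d Q"
  shows "(\<Sum>i<d. (\<Sum>j<d. Q (i, j) * x j)\<^sup>2) = (\<Sum>j<d. (x j)\<^sup>2)"
proof -
  have "(\<Sum>i<d. (\<Sum>j<d. Q (i, j) * x j)\<^sup>2)
    = (\<Sum>i<d. \<Sum>j<d. \<Sum>k<d. x j * x k * (Q (i, j) * Q (i, k)))"
    unfolding power2_eq_square sum_product by (intro sum.cong refl) simp
  also have "\<dots> = (\<Sum>j<d. \<Sum>i<d. \<Sum>k<d. x j * x k * (Q (i, j) * Q (i, k)))"
    by (rule sum.swap)
  also have "\<dots> = (\<Sum>j<d. \<Sum>k<d. \<Sum>i<d. x j * x k * (Q (i, j) * Q (i, k)))"
    by (intro sum.cong refl sum.swap)
  also have "\<dots> = (\<Sum>j<d. \<Sum>k<d. if j = k then (x j)\<^sup>2 else 0)"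
  proof (intro sum.cong refl)
    fix j k assume "j \<in> {..<d}" "k \<in> {..<d}"
    then have "(\<Sum>i<d. Q (i, j) * Q (i, k)) = (if j = k then 1 else 0)"
      using assms by (simp add: orthogonal_d_def)
    then show "(\<Sum>i<d. x j * x k * (Q (i, j) * Q (i, k))) = (if j = k then (x j)\<^sup>2 else 0)"
      by (simp only: sum_distrib_left[symmetric]) (simp add: power2_eq_square)
  qed
  finally show ?thesis by simp
qed

lemma vnorm_diff_triangle: "vnorm d (x - z) \<le> vnorm d (x - y) + vnorm d (y - z)"
  using L2_set_triangle_ineq[of "x - y" "y - z" "{..<d}"] by (simp add: vnorm_def L2_set_def)

lemma vnorm_minus_commute: "vnorm d (x - y) = vnorm d (y - x)"
  by (simp add: vnorm_def power2_commute)

definition set_dist :: "nat \<Rightarrow> (nat \<Rightarrow> real) set \<Rightarrow> (nat \<Rightarrow> real) \<Rightarrow> real" where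
  "set_dist d A y = Min ((\<lambda>a. vnorm d (y - a)) ` A)"

text \<open>A point of \<open>A\<close> nearest to \<open>y\<close> is a competitor for
  \<open>x\<close>; the triangle inequality and symmetry finish.\<close>

lemma set_dist_lip1:
  assumes "finite A" "A \<noteq> {}"
  shows "set_dist d A \<in> lip1 d"
proof -
  have le: "set_dist d A x \<le> set_dist d A y + vnorm d (x - y)" for x y
  proof -
    have "set_dist d A y \<in> (\<lambda>a. vnorm d (y - a)) ` A"
      unfolding set_dist_def using assms by (intro Min_in) auto
    then obtain a where a: "a \<in> A" "set_dist d A y = vnorm d (y - a)" by blast
    have "set_dist d A x \<le> vnorm d (x - a)"
      using a assms by (simp add: set_dist_def)
    also have "\<dots> \<le> vnorm d (x - y) + vnorm d (y - a)" by (rule vnorm_diff_triangle)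
    finally show ?thesis using a by simp
  qed
  have "\<bar>set_dist d A x - set_dist d A y\<bar> \<le> vnorm d (x - y)" for x y
    using le[of x y] le[of y x] vnorm_minus_commute[of d y x] by simp
  then show ?thesis by (simp add: lip1_def)
qed

lemma set_dist_nonneg:
  assumes "finite A" "A \<noteq> {}"
  shows "0 \<le> set_dist d A y"
  unfolding set_dist_def using assms by (intro Min.boundedI) (auto simp: vnorm_def sum_nonneg)

lemma set_dist_zero:
  assumes "finite A" "a \<in> A"
  shows "set_dist d A a = 0"
proof (rule antisym)
  show "set_dist d A a \<le> 0"
    using assms by (auto simp: set_dist_def vnorm_def intro!: Min_le image_eqI[of _ _ a])
  show "0 \<le> set_dist d A a"
    using assms by (intro set_dist_nonneg) auto
qed

lemma finite_signs: "finite (signs d)"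
proof -
  have "signs d = {s. \<forall>i. (i \<in> {..<d} \<longrightarrow> s i \<in> {-1, 1}) \<and> (i \<notin> {..<d} \<longrightarrow> s i = 0)}"
    by (simp add: signs_def not_less all_conj_distrib del: insert_iff)
  also have "finite \<dots>" by (rule finite_set_of_finite_funs) auto
  finally show ?thesis .
qed

lemma signs_nonempty: "signs d \<noteq> {}"
proof -
  have "(\<lambda>i. if i < d then 1 else 0) \<in> signs d" by (simp add: signs_def)
  then show ?thesis by blast
qed

text \<open>The vertex \<open>Q s / sqrt d\<close> is a unit vector, so the squared distance is 2
  minus twice the inner product with \<open>y\<close>. Moving \<open>Q\<close> to the other side
  bounds \<open><y, Q s>\<close> by the l1 norm of the transpose of \<open>Q\<close> applied to
  \<open>y\<close>.\<close>

lemma vnorm_rotated_cube_ge: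
  assumes Q: "orthogonal_d d Q" and s: "s \<in> signs d" and y: "(\<Sum>i<d. (y i)\<^sup>2) = 1" and d: "0 < d"
  shows "sqrt (2 - 2 * ((\<Sum>j<d. \<bar>\<Sum>i<d. Q (i, j) * y i\<bar>) / sqrt d))
    \<le> vnorm d (y - (\<lambda>i. matvec d Q s i / sqrt d))"
proof -
  define a where "a i = (\<Sum>j<d. Q (i, j) * s j)" for i
  have s1: "\<bar>s j\<bar> = 1" if "j < d" for j using s that by (auto simp: signs_def)
  have "(\<Sum>i<d. (a i)\<^sup>2) = (\<Sum>j<d. (s j)\<^sup>2)"
    unfolding a_def by (rule orthogonal_d_sum_sq[OF Q])
  also have "\<dots> = (\<Sum>j<d. 1)"
    using s1 by (intro sum.cong refl) (metis lessThan_iff one_power2 power2_abs)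
  finally have a: "(\<Sum>i<d. (a i)\<^sup>2) = d" by simp
  have "(\<Sum>i<d. y i * a i) = (\<Sum>i<d. \<Sum>j<d. s j * (Q (i, j) * y i))"
    by (simp add: a_def sum_distrib_left mult_ac)
  also have "\<dots> = (\<Sum>j<d. s j * (\<Sum>i<d. Q (i, j) * y i))"
    by (subst sum.swap) (simp add: sum_distrib_left)
  also have "\<dots> \<le> (\<Sum>j<d. \<bar>s j * (\<Sum>i<d. Q (i, j) * y i)\<bar>)"
    by (intro sum_mono abs_ge_self)
  also have "\<dots> = (\<Sum>j<d. \<bar>\<Sum>i<d. Q (i, j) * y i\<bar>)"
    using s1 by (simp add: abs_mult)
  finally have ya: "(\<Sum>i<d. y i * a i) \<le> (\<Sum>j<d. \<bar>\<Sum>i<d. Q (i, j) * y i\<bar>)" .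
  have "(\<Sum>i<d. (y i - a i / sqrt d)\<^sup>2)
    = (\<Sum>i<d. (y i)\<^sup>2) - 2 * ((\<Sum>i<d. y i * a i) / sqrt d) + (\<Sum>i<d. (a i)\<^sup>2) / d"
    by (simp add: power2_diff power_divide sum.distrib sum_subtractf sum_divide_distrib
        sum_distrib_left mult.assoc)
  also have "\<dots> = 2 - 2 * ((\<Sum>i<d. y i * a i) / sqrt d)"
    using d by (simp add: y a)
  also have "\<dots> \<ge> 2 - 2 * ((\<Sum>j<d. \<bar>\<Sum>i<d. Q (i, j) * y i\<bar>) / sqrt d)"
    using ya by (simp add: divide_right_mono)
  finally show ?thesis
    by (simp add: vnorm_def matvec_def a_def)
qed

text \<open>Cauchy-Schwarz against the all-ones vector; it supplies the condition
  \<open>t \<le> 1\<close> of the quadratic minorant.\<close>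

lemma sum_abs_le_sqrt:
  fixes x :: "nat \<Rightarrow> real"
  assumes "(\<Sum>i<d. (x i)\<^sup>2) = 1" "0 < d"
  shows "(\<Sum>i<d. \<bar>x i\<bar>) / sqrt d \<le> 1"
  using L2_set_mult_ineq[where A = "{..<d}" and f = "\<lambda>_. 1" and g = x] assms by (simp add: L2_set_def)

section \<open>Numerical bounds\<close>

lemma sqrt_two_over_pi_bounds: "7 / 10 \<le> sqrt (2 / pi)" "sqrt (2 / pi) \<le> 4 / 5"
proof -
  have "(7 / 10)\<^sup>2 \<le> 2 / pi"
    using pi_approx by (simp add: power2_eq_square field_simps)
  then show "7 / 10 \<le> sqrt (2 / pi)" by (rule real_le_rsqrt)
  have "2 / pi \<le> (4 / 5)\<^sup>2"
    using pi_approx by (simp add: power2_eq_square field_simps)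
  then show "sqrt (2 / pi) \<le> 4 / 5" by (intro real_le_lsqrt) simp_all
qed

text \<open>The radicand is at least 0.4, while 0.62 squared is 0.3844. The margin over 0.6 absorbs
  the error term \<open>6 / d\<close> at the larger threshold.\<close>

lemma limit_constant_ge: "31 / 50 \<le> sqrt (2 - 2 * sqrt (2 / pi))"
proof (rule real_le_rsqrt)
  show "(31 / 50)\<^sup>2 \<le> 2 - 2 * sqrt (2 / pi)"
    using sqrt_two_over_pi_bounds by (simp add: power2_eq_square)
qed

section \<open>Mean of the quadratic minorant\<close>

context haar_orthogonal
begin

lemma integral_quadratic_minorant:
  fixes t f :: real
  defines "t \<equiv> sqrt (2 / pi)" and "f \<equiv> sqrt (2 - 2 * t)"
  shows "f - 6 / d \<le> (\<integral>R. f - (l1 R - t) / f - 2 / f ^ 3 * (l1 R - t)\<^sup>2 \<partial>M)"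
proof -
  define v where "v = (\<integral>R. (l1 R - t)\<^sup>2 \<partial>M)"
  define e where "e = (\<integral>R. l1 R \<partial>M)"
  define a where "a = (1 - t\<^sup>2) / d"
  define k where "k = 1 / real d"
  have "0 \<le> k" by (simp add: k_def)
  have t: "7 / 10 \<le> t" "t\<^sup>2 = 2 / pi"
    using sqrt_two_over_pi_bounds by (simp_all add: t_def)
  have f: "3 / 5 \<le> f"
    using limit_constant_ge by (simp add: f_def t_def)
  have int: "integrable M (\<lambda>R. (l1 R - t)\<^sup>2)"
    using integrable_l1 integrable_l1_sq by (simp add: power2_diff)
  have "v = (\<integral>R. (l1 R)\<^sup>2 + (t\<^sup>2 - 2 * t * l1 R) \<partial>M)"
    unfolding v_def by (simp add: power2_diff algebra_simps)
  also have "\<dots> = (\<integral>R. (l1 R)\<^sup>2 \<partial>M) + (t\<^sup>2 - 2 * t * e)"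
    using integrable_l1 integrable_l1_sq by (simp add: e_def prob_space)
  \<comment> \<open>One identity gives both bounds: \<open>v \<ge> 0\<close> limits how far the mean
    \<open>e\<close> exceeds \<open>t\<close>, and \<open>e \<ge> t\<close> gives
    \<open>v \<le> a\<close>.\<close>
  finally have v_eq: "v = a - 2 * t * (e - t)"
    unfolding integral_l1_sq t(2)[symmetric] by (simp add: algebra_simps power2_eq_square a_def)
  have "(7 / 10)\<^sup>2 \<le> t\<^sup>2" using t by (intro power_mono) auto
  then have a: "a \<le> 51 / 100 * k"
    using mult_right_mono[OF _ \<open>0 \<le> k\<close>, of "1 - t\<^sup>2" "51 / 100"]
    by (simp add: a_def k_def power2_eq_square)
  have v: "v \<ge> 0" by (simp add: v_def)
  have e: "e \<ge> t" using integral_l1_ge by (simp add: e_def t_def)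
  have "7 / 5 * (e - t) \<le> 2 * t * (e - t)" using e t by (intro mult_right_mono) auto
  also have "\<dots> \<le> a" using v v_eq by simp
  finally have 1: "e - t \<le> 5 / 7 * a" by simp
  have 2: "v \<le> a" using v_eq e t by simp
  have "(e - t) / f \<le> (5 / 7 * a) / (3 / 5)"
    using 1 e f by (intro frac_le) auto
  moreover have "2 / f ^ 3 * v \<le> 2 / (3 / 5) ^ 3 * a"
    using 2 v f by (intro mult_mono frac_le power_mono) auto
  moreover have "(5 / 7 * a) / (3 / 5) + 2 / (3 / 5) ^ 3 * a \<le> 6 * k"
    \<comment> \<open>The coefficients 25/21 and 250/27 add up to less than 10.46; times 51/100 this
      is below 6.\<close>
    using a \<open>0 \<le> k\<close> by (simp add: power3_eq_cube)
  moreover have "6 / real d = 6 * k" by (simp add: k_def)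
  ultimately have "f - 6 / d \<le> f - (e - t) / f - 2 / f ^ 3 * v" by linarith
  also have "\<dots> = (\<integral>R. f - (l1 R - t) / f - 2 / f ^ 3 * (l1 R - t)\<^sup>2 \<partial>M)"
    using integrable_l1 int by (simp add: e_def v_def prob_space)
  finally show ?thesis .
qed

end

subsection \<open>The lower bound\<close>

definition walsh :: "nat \<Rightarrow> nat \<times> nat \<Rightarrow> real" where
  "walsh m = (\<lambda>(i, j). hadamard m (i, j) / sqrt (2 ^ m))"

lemma walsh_sym: "walsh m (i, j) = walsh m (j, i)"
  by (simp add: walsh_def hadamard_sym[of m i])

lemma orthogonal_d_walsh: "orthogonal_d (2 ^ m) (walsh m)"
  unfolding orthogonal_d_def
  by (simp add: walsh_def hadamard_orthogonal sum_divide_distrib[symmetric])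

definition cube_image :: "nat \<Rightarrow> (nat \<Rightarrow> real) set" where
  "cube_image m = (\<lambda>s i. matvec (2 ^ m) (walsh m) s i / sqrt (2 ^ m)) ` signs (2 ^ m)"

lemma finite_cube_image: "finite (cube_image m)" and cube_image_nonempty: "cube_image m \<noteq> {}"
  using finite_signs signs_nonempty by (auto simp: cube_image_def)

text \<open>The inner transform picks out the first column of the Hadamard matrix, all ones, times
  the sign \<open>s2 0\<close>. Multiplying by \<open>s1\<close> gives another sign vector, and
  \<open>1 / d\<close> splits into two factors \<open>1 / sqrt d\<close>, one of which normalises
  the outer transform.\<close>

lemma Tmap_unit_vector:
  assumes "s1 \<in> signs (2 ^ m)" "s2 \<in> signs (2 ^ m)"
  shows "Tmap m s1 s2 (\<lambda>i. if i = 0 then 1 else 0) \<in> cube_image m"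
proof -
  let ?d = "2 ^ m :: nat"
  have "matvec ?d (hadamard m) (diagmul s2 (\<lambda>i. if i = 0 then 1 else 0))
    = (\<lambda>i. if i < ?d then s2 0 else 0)"
    by (simp add: matvec_def diagmul_def hadamard_first_col fun_eq_iff
        if_distrib[of "\<lambda>x. _ * x"] cong: if_cong)
  moreover have "diagmul s1 (\<lambda>i. if i < ?d then s2 0 else 0) \<in> signs ?d"
    using assms by (fastforce simp: signs_def diagmul_def)
  moreover have "1 / real ?d * matvec ?d (hadamard m) s i = matvec ?d (walsh m) s i / sqrt (2 ^ m)"
    for s i
    by (simp add: matvec_def walsh_def sum_divide_distrib[symmetric])
  ultimately show ?thesis
    by (auto simp: Tmap_def cube_image_def)
qed

lemma expectation_set_dist_cube_ge:
  assumes M: "haar_orth (2 ^ m) M"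
  shows "sqrt (2 * (1 - sqrt (2 / pi))) - 6 / 2 ^ m
    \<le> (\<integral>R. set_dist (2 ^ m) (cube_image m) (matvec (2 ^ m) R (\<lambda>i. if i = 0 then 1 else 0)) \<partial>M)"
proof -
  define d where "d = (2 ^ m :: nat)"
  interpret haar_orthogonal d M
    using M by unfold_locales (simp_all add: d_def)
  define Y where "Y R = (\<lambda>i. if i < d then R (i, 0) else 0)" for R :: "nat \<times> nat \<Rightarrow> real"
  have Y: "matvec d R (\<lambda>i. if i = 0 then 1 else 0) = Y R" for R
    using dim_pos by (simp add: Y_def matvec_def fun_eq_iff if_distrib[of "\<lambda>x. _ * x"] cong: if_cong)
  let ?C = "cube_image m"
  note fin = finite_cube_image[of m] cube_image_nonempty[of m]
  have "(\<lambda>R. vnorm d (Y R - a)) \<in> borel_measurable M" for a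
    unfolding vnorm_def Y_def by (simp add: fun_diff_def cong: sum.cong)
  then have meas: "(\<lambda>R. set_dist d ?C (Y R)) \<in> borel_measurable M"
    unfolding set_dist_def using fin by (intro borel_measurable_Min)
  obtain a where a: "a \<in> ?C" using fin by blast
  \<comment> \<open>Comparison with one fixed vertex \<open>a\<close> bounds the distance almost
    surely, which yields integrability.\<close>
  have "AE R in M. norm (set_dist d ?C (Y R)) \<le> 1 + vnorm d ((\<lambda>_. 0) - a)"
    using AE_first_col_unit
  proof eventually_elim
    case (elim R)
    have "set_dist d ?C (Y R) \<le> vnorm d (Y R - a)" using fin a by (simp add: set_dist_def)
    also have "\<dots> \<le> vnorm d (Y R - (\<lambda>_. 0)) + vnorm d ((\<lambda>_. 0) - a)" by (rule vnorm_diff_triangle)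
    also have "vnorm d (Y R - (\<lambda>_. 0)) = 1" using elim by (simp add: vnorm_def Y_def)
    finally show ?case unfolding real_norm_def abs_of_nonneg[OF set_dist_nonneg[OF fin]] .
  qed
  then have int: "integrable M (\<lambda>R. set_dist d ?C (Y R))"
    by (intro integrable_const_bound meas)
  define t where "t = sqrt (2 / pi)"
  have t: "t < 1" unfolding t_def using sqrt_two_over_pi_bounds(2) by linarith
  define f where "f = sqrt (2 - 2 * t)"
  define p where "p x = f - (x - t) / f - 2 / f ^ 3 * (x - t)\<^sup>2" for x
  \<comment> \<open>The minorant is phrased as a function of a whole vector so that rotation
    invariance can remove the matrix \<open>walsh m\<close> below.\<close>
  define q where "q x = p ((\<Sum>i<d. \<bar>x i\<bar>) / sqrt d)" for x :: "nat \<Rightarrow> real"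
  have orth: "orthogonal_d d (walsh m)" unfolding d_def by (rule orthogonal_d_walsh)
  have "AE R in M. q (\<lambda>i\<in>{..<d}. \<Sum>k<d. walsh m (i, k) * R (k, 0)) \<le> set_dist d ?C (Y R)"
    using AE_first_col_unit
  proof eventually_elim
    case (elim R)
    define z where "z j = (\<Sum>i<d. walsh m (j, i) * R (i, 0))" for j
    define \<tau> where "\<tau> = (\<Sum>j<d. \<bar>z j\<bar>) / sqrt d"
    have "(\<Sum>j<d. (z j)\<^sup>2) = 1"
      unfolding z_def using orthogonal_d_sum_sq[OF orth, of "\<lambda>i. R (i, 0)"] elim by simp
    then have \<tau>: "\<tau> \<le> 1" unfolding \<tau>_def using dim_pos by (rule sum_abs_le_sqrt)
    have "q (\<lambda>i\<in>{..<d}. \<Sum>k<d. walsh m (i, k) * R (k, 0)) = p \<tau>"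
      by (simp add: q_def \<tau>_def z_def)
    also have "\<dots> \<le> sqrt (2 - 2 * \<tau>)"
      unfolding p_def by (rule sqrt_quadratic_minorant[OF \<tau> t f_def])
    also have "\<dots> \<le> set_dist d ?C (Y R)"
      unfolding set_dist_def
    proof (intro Min.boundedI)
      fix r assume "r \<in> (\<lambda>a. vnorm d (Y R - a)) ` ?C"
      then obtain s where s: "s \<in> signs d" "r = vnorm d (Y R - (\<lambda>i. matvec d (walsh m) s i / sqrt d))"
        by (auto simp: cube_image_def d_def)
      \<comment> \<open>The distance bound involves the transpose of \<open>walsh m\<close>; by
        symmetry it is the same matrix.\<close>
      have "\<tau> = (\<Sum>j<d. \<bar>\<Sum>i<d. walsh m (i, j) * Y R i\<bar>) / sqrt d"
        unfolding \<tau>_def z_def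
      by (intro arg_cong2[of _ _ _ _ "(/)"] sum.cong arg_cong[of _ _ abs] refl)
        (auto simp: Y_def intro: walsh_sym)
      then show "sqrt (2 - 2 * \<tau>) \<le> r"
        using vnorm_rotated_cube_ge[OF orth s(1), of "Y R"] elim dim_pos s(2) by (simp add: Y_def)
    qed (use fin in auto)
    finally show ?case .
  qed
  then have "(\<integral>R. q (\<lambda>i\<in>{..<d}. \<Sum>k<d. walsh m (i, k) * R (k, 0)) \<partial>M) \<le> (\<integral>R. set_dist d ?C (Y R) \<partial>M)"
    using set_dist_nonneg[OF fin] by (intro integral_mono_AE' int) auto
  also have "(\<integral>R. q (\<lambda>i\<in>{..<d}. \<Sum>k<d. walsh m (i, k) * R (k, 0)) \<partial>M) = (\<integral>R. q (\<lambda>i\<in>{..<d}. R (i, 0)) \<partial>M)"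
    unfolding q_def p_def by (intro integral_first_col_rotate orth) measurable
  also have "\<dots> = (\<integral>R. f - (l1 R - t) / f - 2 / f ^ 3 * (l1 R - t)\<^sup>2 \<partial>M)"
    by (simp add: q_def p_def l1_def)
  also have "\<dots> \<ge> f - 6 / d"
    unfolding f_def t_def by (rule integral_quadratic_minorant)
  finally show ?thesis
    unfolding Y[symmetric] by (simp add: f_def t_def d_def right_diff_distrib)
qed

text \<open>One unit vector and one test function bound both suprema from below; the distance to the
  cube image vanishes on the whole support of the sign pairs.\<close>

lemma supW1_ge:
  assumes M: "haar_orth (2 ^ m) M"
  shows "ereal (sqrt (2 * (1 - sqrt (2 / pi))) - 6 / 2 ^ m) \<le> supW1 m M"
proof -
  define u :: "nat \<Rightarrow> real" where "u = (\<lambda>i. if i = 0 then 1 else 0)"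
  let ?F = "set_dist (2 ^ m) (cube_image m)"
  let ?E = "measure_pmf.expectation (rademacher_pair (2 ^ m)) (\<lambda>(s1, s2). ?F (Tmap m s1 s2 u))"
  note fin = finite_cube_image[of m] cube_image_nonempty[of m]
  have u: "u \<in> sphere_d (2 ^ m)"
    by (simp add: sphere_d_def vecs_def vnorm_def u_def if_distrib[of "\<lambda>x. x\<^sup>2"] cong: if_cong)
  have "set_pmf (rademacher_pair (2 ^ m)) = signs (2 ^ m) \<times> signs (2 ^ m)"
    unfolding rademacher_pair_def
    using finite_signs signs_nonempty by (intro set_pmf_of_set) auto
  then have "?E = measure_pmf.expectation (rademacher_pair (2 ^ m)) (\<lambda>_. 0)"
    using fin Tmap_unit_vector
    by (intro integral_cong_AE) (auto simp: AE_measure_pmf_iff u_def set_dist_zero)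
  then have E: "?E = 0" by simp
  have "ereal (sqrt (2 * (1 - sqrt (2 / pi))) - 6 / 2 ^ m)
    \<le> ereal \<bar>?E - (\<integral>R. ?F (matvec (2 ^ m) R u) \<partial>M)\<bar>"
    using expectation_set_dist_cube_ge[OF M, folded u_def] unfolding E by simp
  also have "\<dots> \<le> W1_TX m M u"
    unfolding W1_TX_def by (rule SUP_upper) (rule set_dist_lip1[OF fin])
  also have "\<dots> \<le> supW1 m M"
    unfolding supW1_def by (rule SUP_upper) (rule u)
  finally show ?thesis .
qed

theorem mainTheorem11:
  shows "(\<forall>m M. 2 ^ m \<ge> (256::nat) \<longrightarrow> haar_orth (2 ^ m) M \<longrightarrow> supW1 m M > ereal (1/3))
       \<and> (\<forall>m M. 2 ^ m \<ge> (32768::nat) \<longrightarrow> haar_orth (2 ^ m) M \<longrightarrow> supW1 m M > ereal (6/10))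
       \<and> (\<forall>HM. (\<forall>m. haar_orth (2 ^ m) (HM m)) \<longrightarrow>
            liminf (\<lambda>m. supW1 m (HM m)) \<ge> ereal (sqrt (2 * (1 - sqrt (2 / pi)))))"
proof (intro conjI allI impI)
  \<comment> \<open>The bound is monotone in the dimension, so only the thresholds matter: 0.62 -
    6/256 exceeds 1/3, and 0.62 - 6/32768 exceeds 0.6.\<close>
  have lower: "ereal (31 / 50 - 6 / N) \<le> supW1 m M"
    if "N \<le> 2 ^ m" "0 < N" "haar_orth (2 ^ m) M" for N m :: nat and M
  proof -
    have "real N \<le> real (2 ^ m)" using that(1) by (simp only: of_nat_le_iff)
    then have "6 / 2 ^ m \<le> 6 / real N" using that by (intro divide_left_mono) auto
    then have "31 / 50 - 6 / real N \<le> sqrt (2 * (1 - sqrt (2 / pi))) - 6 / 2 ^ m"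
      using limit_constant_ge by (simp add: right_diff_distrib)
    then show ?thesis using supW1_ge[OF that(3)] ereal_less_eq(3) order_trans by blast
  qed
  fix m M assume M: "haar_orth (2 ^ m) M"
  show "supW1 m M > ereal (1/3)" if "2 ^ m \<ge> (256::nat)"
    by (rule less_le_trans[OF _ lower[OF that _ M]]) simp_all
  show "supW1 m M > ereal (6/10)" if "2 ^ m \<ge> (32768::nat)"
    by (rule less_le_trans[OF _ lower[OF that _ M]]) simp_all
next
  fix HM assume HM: "\<forall>m. haar_orth (2 ^ m) (HM m)"
  let ?c = "sqrt (2 * (1 - sqrt (2 / pi)))"
  have "(\<lambda>m. ?c - 6 * (1 / 2) ^ m) \<longlonglongrightarrow> ?c - 6 * 0"
    by (intro tendsto_intros LIMSEQ_realpow_zero) auto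
  then have "(\<lambda>m. ereal (?c - 6 / 2 ^ m)) \<longlonglongrightarrow> ereal ?c"
    by (simp add: power_divide)
  then have "ereal ?c = liminf (\<lambda>m. ereal (?c - 6 / 2 ^ m))"
    by (intro lim_imp_Liminf[symmetric]) simp_all
  also have "\<dots> \<le> liminf (\<lambda>m. supW1 m (HM m))"
    using HM supW1_ge by (intro Liminf_mono always_eventually) auto
  finally show "ereal ?c \<le> liminf (\<lambda>m. supW1 m (HM m))" .
qed

end
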